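(* Let $\mathcal H=(V,E)$ be a connected hypergraph with a ribbon structure on $\mathrm{Bip}\,\mathcal H$, a base node, and a base edge fixed. For each hypertree $\mathbf f$ on $E$ there is exactly one $E$-cut Jaeger tree $T$ such that $\mathbf f_E(T)=\mathbf f$.
   Context: $\mathrm{Bip}\,\mathcal H$ is the bipartite graph with color classes $V$ (violet) and $E$ (emerald), $v$ joined to $e$ iff $v\in e$; connected means $\mathrm{Bip}\,\mathcal H$ is connected. A hypertree on $E$ is $\mathbf f:E\to\mathbb Z_{\ge0}$ such that some spanning tree $T$ of $\mathrm{Bip}\,\mathcal H$ has $d_T(e)=\mathbf f(e)+1$ for all $e\in E$; for a spanning tree $T$, $\mathbf f_E(T)(e)=d_T(e)-1$. A ribbon structure assigns to each node $x$ a cyclic permutation of its incident edges; $xy^+$ is the edge following $xy$ at $x$. Base node $b_0$, incident base edge $b_0b_1$. Tour of a spanning tree $T$: sequence of pairs (current node, current edge) starting with $(b_0,b_0b_1)$; from $(x,xy)$ go to $(x,xy^+)$ if $xy\notin T$ and to $(y,yx^+)$ if $xy\in T$; stop right before $(b_0,b_0b_1)$ would recur. Each edge $xy$ appears exactly twice, as $(x,xy)$ and $(y,xy)$. A non-edge $xy$ of $T$ is cut at $x$ if $(x,xy)$ precedes $(y,xy)$. $T$ is an $E$-cut Jaeger tree if every non-edge of $T$ is cut at its emerald endpoint. *)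

theory Defs
  imports Main "HOL-Combinatorics.Orbits"
begin

text \<open>
  A finite simple graph is given by its node set \<open>N\<close> and its edge set \<open>F\<close>, every edge being the
  set of its two endpoints. The notion \<open>tree\<close> of the AFP entry Graph_Theory does not fit here: it
  forbids directed cycles only.
\<close>

definition incident :: "'n set set \<Rightarrow> 'n \<Rightarrow> 'n set set" where
  "incident F x = {\<epsilon> \<in> F. x \<in> \<epsilon>}"

definition node_degree :: "'n set set \<Rightarrow> 'n \<Rightarrow> nat" where
  "node_degree F x = card (incident F x)"

definition connected_graph :: "'n set \<Rightarrow> 'n set set \<Rightarrow> bool" where
  "connected_graph N F \<longleftrightarrow>
     N \<noteq> {} \<and> (\<forall>x\<in>N. \<forall>y\<in>N. (x, y) \<in> {(u, w). {u, w} \<in> F}\<^sup>*)"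

definition graph_cycle :: "'n set set \<Rightarrow> 'n list \<Rightarrow> bool" where
  "graph_cycle F xs \<longleftrightarrow> 3 \<le> length xs \<and> distinct xs \<and>
     (\<forall>i<length xs. {xs ! i, xs ! (Suc i mod length xs)} \<in> F)"

definition is_spanning_tree :: "'n set \<Rightarrow> 'n set set \<Rightarrow> 'n set set \<Rightarrow> bool" where
  "is_spanning_tree N F T \<longleftrightarrow> T \<subseteq> F \<and> connected_graph N T \<and> (\<nexists>xs. graph_cycle T xs)"

text \<open>
  The hyperedges are an indexed family: \<open>E\<close> is the set of labels and \<open>mem e\<close> is the vertex set of
  the hyperedge \<open>e\<close>, so hyperedges may repeat.
\<close>

definition hypergraph :: "'v set \<Rightarrow> 'e set \<Rightarrow> ('e \<Rightarrow> 'v set) \<Rightarrow> bool" where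
  "hypergraph V E mem \<longleftrightarrow>
     finite V \<and> finite E \<and> (\<forall>e\<in>E. mem e \<noteq> {} \<and> mem e \<subseteq> V)"

text \<open>In \<open>Bip\<close>, violet nodes are tagged by \<open>Inl\<close> and emerald nodes by \<open>Inr\<close>.\<close>

definition bip_nodes :: "'v set \<Rightarrow> 'e set \<Rightarrow> ('v + 'e) set" where
  "bip_nodes V E = V <+> E"

definition bip_edges :: "'v set \<Rightarrow> 'e set \<Rightarrow> ('e \<Rightarrow> 'v set) \<Rightarrow> ('v + 'e) set set" where
  "bip_edges V E mem = {{Inl v, Inr e} | v e. v \<in> V \<and> e \<in> E \<and> v \<in> mem e}"

definition connected_hypergraph :: "'v set \<Rightarrow> 'e set \<Rightarrow> ('e \<Rightarrow> 'v set) \<Rightarrow> bool" where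
  "connected_hypergraph V E mem \<longleftrightarrow>
     hypergraph V E mem \<and> connected_graph (bip_nodes V E) (bip_edges V E mem)"

abbreviation bip_spanning_tree ::
    "'v set \<Rightarrow> 'e set \<Rightarrow> ('e \<Rightarrow> 'v set) \<Rightarrow> ('v + 'e) set set \<Rightarrow> bool" where
  "bip_spanning_tree V E mem T \<equiv> is_spanning_tree (bip_nodes V E) (bip_edges V E mem) T"

text \<open>Only the values of \<open>f\<close> on \<open>E\<close> are relevant.\<close>

definition hypertree :: "'v set \<Rightarrow> 'e set \<Rightarrow> ('e \<Rightarrow> 'v set) \<Rightarrow> ('e \<Rightarrow> nat) \<Rightarrow> bool" where
  "hypertree V E mem f \<longleftrightarrow>
     (\<exists>T. bip_spanning_tree V E mem T \<and> (\<forall>e\<in>E. node_degree T (Inr e) = f e + 1))"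

text \<open>
  The subtraction does not truncate for \<open>e \<in> E\<close> and a spanning tree \<open>T\<close>: hyperedges are nonempty, so
  there is more than one node and \<open>Inr e\<close> has positive degree in \<open>T\<close>.
\<close>

definition f_E :: "('v + 'e) set set \<Rightarrow> 'e \<Rightarrow> nat" where
  "f_E T e = node_degree T (Inr e) - 1"

text \<open>\<open>rot x \<epsilon>\<close> is the edge following \<open>\<epsilon>\<close> at \<open>x\<close>.\<close>

definition ribbon_structure :: "'n set \<Rightarrow> 'n set set \<Rightarrow> ('n \<Rightarrow> 'n set \<Rightarrow> 'n set) \<Rightarrow> bool" where
  "ribbon_structure N F rot \<longleftrightarrow>
     (\<forall>x\<in>N. rot x permutes incident F x \<and>
            (incident F x \<noteq> {} \<longrightarrow> cyclic_on (rot x) (incident F x)))"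

definition other_end :: "'n \<Rightarrow> 'n set \<Rightarrow> 'n" where
  "other_end x \<epsilon> = (THE y. \<epsilon> = {x, y})"

fun tour_step :: "('n \<Rightarrow> 'n set \<Rightarrow> 'n set) \<Rightarrow> 'n set set \<Rightarrow> 'n \<times> 'n set \<Rightarrow> 'n \<times> 'n set" where
  "tour_step rot T (x, \<epsilon>) =
     (if \<epsilon> \<in> T then (other_end x \<epsilon>, rot (other_end x \<epsilon>) \<epsilon>) else (x, rot x \<epsilon>))"

definition tour_length ::
    "('n \<Rightarrow> 'n set \<Rightarrow> 'n set) \<Rightarrow> 'n set set \<Rightarrow> 'n \<times> 'n set \<Rightarrow> nat" where
  "tour_length rot T s = (LEAST n. 0 < n \<and> (tour_step rot T ^^ n) s = s)"

definition tour ::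
    "('n \<Rightarrow> 'n set \<Rightarrow> 'n set) \<Rightarrow> 'n set set \<Rightarrow> 'n \<times> 'n set \<Rightarrow> ('n \<times> 'n set) list" where
  "tour rot T s = map (\<lambda>i. (tour_step rot T ^^ i) s) [0..<tour_length rot T s]"

definition precedes :: "'a list \<Rightarrow> 'a \<Rightarrow> 'a \<Rightarrow> bool" where
  "precedes ps p q \<longleftrightarrow> (\<exists>i j. i < j \<and> j < length ps \<and> ps ! i = p \<and> ps ! j = q)"

definition cut_at ::
    "('n \<Rightarrow> 'n set \<Rightarrow> 'n set) \<Rightarrow> 'n \<times> 'n set \<Rightarrow> 'n set set \<Rightarrow> 'n set \<Rightarrow> 'n \<Rightarrow> bool" where
  "cut_at rot s T \<epsilon> x \<longleftrightarrow> precedes (tour rot T s) (x, \<epsilon>) (other_end x \<epsilon>, \<epsilon>)"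

definition E_cut_Jaeger_tree ::
    "'v set \<Rightarrow> 'e set \<Rightarrow> ('e \<Rightarrow> 'v set) \<Rightarrow> ('v + 'e \<Rightarrow> ('v + 'e) set \<Rightarrow> ('v + 'e) set) \<Rightarrow>
     ('v + 'e) \<times> ('v + 'e) set \<Rightarrow> ('v + 'e) set set \<Rightarrow> bool" where
  "E_cut_Jaeger_tree V E mem rot s T \<longleftrightarrow>
     bip_spanning_tree V E mem T \<and>
     (\<forall>\<epsilon> \<in> bip_edges V E mem - T. \<forall>e. Inr e \<in> \<epsilon> \<longrightarrow> cut_at rot s T \<epsilon> (Inr e))"

end

theory Submission
  imports Defs
begin

text \<open>
  A tour is a sequence of keep-or-cut decisions, so two distinct trees have a first disagreement.
  If both are \<open>E\<close>-cut Jaeger trees, it occurs at an emerald node, and counting edges on one side of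
  the fundamental cut of the edge in question shows that the emerald degrees differ. For existence,
  compare the trees realizing \<open>f\<close> lexicographically along their tours, preferring to cut at emerald
  and to keep at violet nodes: a maximal tree is \<open>E\<close>-cut, because an edge cut at its violet end can
  be exchanged for a tree edge at the same emerald node, which improves the first affected decision.
\<close>

section \<open>Bridges and trees\<close>

text \<open>The ribbon structure is arbitrary, so no planarity is available. Its substitute is
  \<open>visit_interval\<close>: in the tour of a tree, the half-edges beyond a tree edge, as seen
  from the base node, form one contiguous block. It turns sides of fundamental cuts into
  inequalities between visiting times. The first disagreement is emerald because at a violet node
  the tree that cuts the edge must have met it before at its emerald end, in the common part of the
  tours, and the trees would have disagreed there. Only emerald degrees are prescribed: hence the
  count sorts edges by their emerald ends, and the exchange has to stay at one emerald node while
  violet degrees may change.\<close>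

definition linked :: "'n set set \<Rightarrow> ('n \<times> 'n) set" where
  "linked A = {(u, w). {u, w} \<in> A}\<^sup>*"

lemma linked_refl [simp, intro]: "(u, u) \<in> linked A"
  by (simp add: linked_def)

lemma linked_edge: "{u, w} \<in> A \<Longrightarrow> (u, w) \<in> linked A"
  by (auto simp: linked_def)

lemma linked_trans: "(u, w) \<in> linked A \<Longrightarrow> (w, z) \<in> linked A \<Longrightarrow> (u, z) \<in> linked A"
  by (simp add: linked_def)

lemma linked_sym: "(u, w) \<in> linked A \<Longrightarrow> (w, u) \<in> linked A"
proof -
  have "sym (linked A)"
    unfolding linked_def by (rule sym_rtrancl) (auto simp: sym_def insert_commute)
  then show "(u, w) \<in> linked A \<Longrightarrow> (w, u) \<in> linked A"
    by (auto dest: symD)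
qed

lemma linked_mono: "A \<subseteq> B \<Longrightarrow> linked A \<subseteq> linked B"
  unfolding linked_def by (rule rtrancl_mono) auto

lemma linked_induct [consumes 1, case_names refl step]:
  assumes "(u, r) \<in> linked A" "P r"
    and "\<And>u w. {u, w} \<in> A \<Longrightarrow> (w, r) \<in> linked A \<Longrightarrow> P w \<Longrightarrow> P u"
  shows "P u"
  using assms(1) unfolding linked_def
  by (induction rule: converse_rtrancl_induct)
     (use assms(2,3) in \<open>auto simp: linked_def\<close>)

text \<open>Keep only the parts of the path before the first and after the last use of the new edge.
  If they meet it at the same end, they join inside \<open>A\<close>; otherwise its two directions
  give the other cases.\<close>

lemma linked_insert:
  assumes "(a, b) \<in> linked (insert {v, e} A)"
  shows "(a, b) \<in> linked A \<or> ((a, v) \<in> linked A \<and> (e, b) \<in> linked A)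
    \<or> ((a, e) \<in> linked A \<and> (v, b) \<in> linked A)"
  using assms
proof (induction rule: linked_induct)
  case (step u w)
  show ?case
  proof (cases "{u, w} \<in> A")
    case True
    then show ?thesis using step.IH linked_trans[OF linked_edge[OF True]] by blast
  next
    case False
    then have "u = v \<and> w = e \<or> u = e \<and> w = v"
      using step.hyps by (auto simp: doubleton_eq_iff)
    then show ?thesis using step.IH by auto
  qed
qed auto

lemma linked_delete_split:
  assumes "(z, x) \<in> linked T"
  shows "(z, x) \<in> linked (T - {{x, y}}) \<or> (z, y) \<in> linked (T - {{x, y}})"
  using assms
proof (induction rule: linked_induct)
  case (step u w)
  show ?case
  proof (cases "{u, w} = {x, y}")
    case True
    then show ?thesis by (auto simp: doubleton_eq_iff)
  next
    case False
    then have "(u, w) \<in> linked (T - {{x, y}})" using step.hyps by (auto intro: linked_edge)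
    from linked_trans[OF this] show ?thesis using step.IH by blast
  qed
qed auto

text \<open>Cut the walk at its last visit to \<open>z\<close>: what follows starts at a neighbour
  \<open>p\<close> and uses no edge at \<open>z\<close>. With root \<open>r\<close>,
  \<open>p\<close> serves as a parent of \<open>z\<close>.\<close>

lemma linked_first_edge:
  assumes "(z, r) \<in> linked T" "z \<noteq> r"
  obtains p where "{z, p} \<in> T" "(p, r) \<in> linked {\<delta> \<in> T. z \<notin> \<delta>}"
proof -
  have "(u, r) \<in> linked {\<delta> \<in> T. z \<notin> \<delta>} \<or> (\<exists>p. {z, p} \<in> T \<and> (p, r) \<in> linked {\<delta> \<in> T. z \<notin> \<delta>})"
    if "(u, r) \<in> linked T" for u
    using that
  proof (induction rule: linked_induct)
    case (step u w)
    have nz: "(z, r) \<notin> linked {\<delta> \<in> T. z \<notin> \<delta>}"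
      using assms(2) unfolding linked_def by (auto elim: converse_rtranclE)
    show ?case
    proof (cases "u = z")
      case True
      then show ?thesis using step by auto
    next
      case False
      show ?thesis
      proof (cases "w = z")
        case True
        then show ?thesis using step nz by auto
      next
        case False
        then have "(u, w) \<in> linked {\<delta> \<in> T. z \<notin> \<delta>}"
          using step.hyps \<open>u \<noteq> z\<close> by (auto intro: linked_edge)
        from linked_trans[OF this] show ?thesis using step.IH by blast
      qed
    qed
  qed auto
  moreover have "(z, r) \<notin> linked {\<delta> \<in> T. z \<notin> \<delta>}"
    using assms(2) unfolding linked_def by (auto elim: converse_rtranclE)
  ultimately show ?thesis using assms(1) that by blast
qed

lemma linked_distinct_path:
  assumes "(x, y) \<in> linked A"
  shows "\<exists>xs. xs \<noteq> [] \<and> distinct xs \<and> hd xs = x \<and> last xs = y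
    \<and> successively (\<lambda>u w. {u, w} \<in> A) xs"
  using assms
proof (induction rule: linked_induct)
  case refl
  show ?case by (rule exI[of _ "[y]"]) auto
next
  case (step u w)
  then obtain xs where xs: "xs \<noteq> []" "distinct xs" "hd xs = w" "last xs = y"
    "successively (\<lambda>u w. {u, w} \<in> A) xs" by blast
  show ?case
  proof (cases "u \<in> set xs")
    case True
    then obtain ys zs where "xs = ys @ u # zs" by (auto dest: split_list)
    then show ?thesis using xs
      by (intro exI[of _ "u # zs"]) (auto simp: successively_append_iff)
  next
    case False
    then show ?thesis using xs step.hyps
      by (intro exI[of _ "u # xs"]) (auto simp: successively_Cons)
  qed
qed

text \<open>Acyclicity in the form used by the exchange and counting arguments. Reflexivity of
  \<open>linked\<close> makes it exclude loops as well, which \<open>graph_cycle\<close> cannot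
  detect.\<close>

definition bridges :: "'n set set \<Rightarrow> bool" where
  "bridges T \<longleftrightarrow> (\<forall>x y. {x, y} \<in> T \<longrightarrow> (x, y) \<notin> linked (T - {{x, y}}))"

lemma acyclic_imp_bridges:
  assumes "\<nexists>xs. graph_cycle T xs" "\<And>x. {x} \<notin> T"
  shows "bridges T"
  unfolding bridges_def
proof (intro allI impI notI)
  fix x y
  assume xy: "{x, y} \<in> T" and "(x, y) \<in> linked (T - {{x, y}})"
  then obtain xs where xs: "xs \<noteq> []" "distinct xs" "hd xs = x" "last xs = y"
    "successively (\<lambda>u w. {u, w} \<in> T - {{x, y}}) xs" using linked_distinct_path by metis
  have "x \<noteq> y" using xy assms(2) by auto
  \<comment> \<open>Length 1 would force \<open>x = y\<close>, and length 2 would use the deleted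
    edge itself.\<close>
  have len: "3 \<le> length xs"
  proof (rule ccontr)
    assume "\<not> 3 \<le> length xs"
    moreover have "length xs \<noteq> 0" using xs(1) by simp
    ultimately have "length xs = 1 \<or> length xs = 2" by linarith
    then show False
    proof
      assume "length xs = 1"
      then obtain a where "xs = [a]" by (auto simp: length_Suc_conv)
      then show False using xs \<open>x \<noteq> y\<close> by auto
    next
      assume "length xs = 2"
      then obtain a b where "xs = [a, b]" by (auto simp: length_Suc_conv numeral_2_eq_2)
      then show False using xs by auto
    qed
  qed
  have "{xs ! i, xs ! (Suc i mod length xs)} \<in> T" if "i < length xs" for i
  proof (cases "Suc i < length xs")
    case True
    then show ?thesis using xs(5) by (auto simp: successively_conv_nth)
  next
    case False
    then have "Suc i = length xs" using that by auto
    then have "i = length xs - 1" "Suc i mod length xs = 0" by auto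
    then have "xs ! i = y" "xs ! (Suc i mod length xs) = x"
      using xs by (auto simp: last_conv_nth hd_conv_nth)
    then show ?thesis using xy by (simp add: insert_commute)
  qed
  then have "graph_cycle T xs" using len xs(2) by (auto simp: graph_cycle_def)
  then show False using assms(1) by blast
qed

lemma bridges_imp_acyclic:
  assumes "bridges T"
  shows "\<not> graph_cycle T xs"
proof
  assume c: "graph_cycle T xs"
  define n where "n = length xs"
  have n: "3 \<le> n" "distinct xs" and e: "\<And>i. i < n \<Longrightarrow> {xs ! i, xs ! (Suc i mod n)} \<in> T"
    using c by (auto simp: graph_cycle_def n_def)
  let ?\<epsilon> = "{xs ! 0, xs ! (n - 1)}"
  have "(xs ! 0, xs ! i) \<in> linked (T - {?\<epsilon>})" if "i < n" for i
    using that
  proof (induction i)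
    case (Suc i)
    have "{xs ! i, xs ! Suc i} \<in> T" using e[of i] Suc by auto
    moreover have "{xs ! i, xs ! Suc i} \<noteq> ?\<epsilon>"
    proof -
      have "Suc i < length xs" "0 < length xs" "n - 1 < length xs" "i < length xs"
        using Suc n n_def by auto
      then show ?thesis
        using n by (auto simp: doubleton_eq_iff nth_eq_iff_index_eq)
    qed
    ultimately have "(xs ! i, xs ! Suc i) \<in> linked (T - {?\<epsilon>})" by (simp add: linked_edge)
    then show ?case using Suc linked_trans[of "xs ! 0" "xs ! i"] by simp
  qed auto
  from this[of "n - 1"] have "(xs ! 0, xs ! (n - 1)) \<in> linked (T - {?\<epsilon>})" using n by auto
  moreover have "?\<epsilon> \<in> T" using e[of "n - 1"] n by (auto simp: insert_commute)
  ultimately show False using assms by (auto simp: bridges_def)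
qed

text \<open>The new edge is a bridge because \<open>v\<close> lies on the side of \<open>p\<close>,
  away from \<open>e\<close>. If an old edge \<open>{a, b}\<close> had a detour, it would use the
  new edge, and the rest of it together with \<open>{a, b}\<close> would link \<open>v\<close> and
  \<open>e\<close> without the new edge.\<close>

lemma bridges_exchange:
  assumes br: "bridges T" and ep: "{e, p} \<in> T" and pv: "(p, v) \<in> linked (T - {{e, p}})"
    and loop: "\<And>x. {x} \<notin> T"
  shows "bridges (insert {v, e} (T - {{e, p}}))"
  unfolding bridges_def
proof (intro allI impI notI)
  fix a b
  let ?A = "T - {{e, p}}"
  let ?T = "insert {v, e} ?A"
  assume ab: "{a, b} \<in> ?T" and l: "(a, b) \<in> linked (?T - {{a, b}})"
  have nep: "(e, p) \<notin> linked ?A" using br ep by (auto simp: bridges_def)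
  then have nve: "(v, e) \<notin> linked ?A" using linked_trans[OF pv, of e] linked_sym[of p e ?A] by blast
  show False
  proof (cases "{a, b} = {v, e}")
    case True
    have "linked (?T - {{a, b}}) \<subseteq> linked ?A" using True by (intro linked_mono) auto
    then have "(a, b) \<in> linked ?A" using l by auto
    then show False using True nve linked_sym by (metis doubleton_eq_iff)
  next
    case False
    then have abA: "{a, b} \<in> ?A" using ab by auto
    let ?B = "?A - {{a, b}}"
    have "?T - {{a, b}} = insert {v, e} ?B" using False by auto
    then have c: "(a, b) \<in> linked ?B \<or> ((a, v) \<in> linked ?B \<and> (e, b) \<in> linked ?B)
      \<or> ((a, e) \<in> linked ?B \<and> (v, b) \<in> linked ?B)"
      using l linked_insert by metis
    have BT: "linked ?B \<subseteq> linked (T - {{a, b}})" by (intro linked_mono) auto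
    have BA: "linked ?B \<subseteq> linked ?A" by (intro linked_mono) auto
    have "(a, b) \<notin> linked ?B" using br abA BT by (auto simp: bridges_def)
    moreover have "(a, b) \<in> linked ?A" using abA by (rule linked_edge)
    moreover have *: "(v, e) \<in> linked ?A"
      if "(c, v) \<in> linked ?B" "(e, d) \<in> linked ?B" "(c, d) \<in> linked ?A" for c d
      using that BA linked_trans[OF linked_sym[of c v ?A] linked_trans[OF that(3) linked_sym[of e d ?A]]]
      by blast
    ultimately have "(v, e) \<in> linked ?A"
      using c *[of a b] *[of b a] linked_sym[of a b ?A] linked_sym[of a e ?B] linked_sym[of v b ?B]
      by blast
    then show False using nve by simp
  qed
qed

text \<open>Root \<open>C\<close> at \<open>x\<close> and map every other node to the edge towards
  its parent. Two nodes sharing this edge would be parents of each other, and both would reach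
  \<open>x\<close> without it, so it would not be a bridge.\<close>

lemma card_linked_class_le:
  assumes "bridges A" "finite A" "x \<in> C" "\<And>z. z \<in> C \<Longrightarrow> (z, x) \<in> linked A"
    and "\<And>z p. z \<in> C \<Longrightarrow> {z, p} \<in> A \<Longrightarrow> p \<in> C"
  shows "card C \<le> card {\<delta> \<in> A. \<delta> \<subseteq> C} + 1"
proof -
  define par where "par z = (SOME p. {z, p} \<in> A \<and> (p, x) \<in> linked {\<delta> \<in> A. z \<notin> \<delta>})" for z
  have par: "{z, par z} \<in> A" "(par z, x) \<in> linked {\<delta> \<in> A. z \<notin> \<delta>}" if "z \<in> C - {x}" for z
  proof -
    have "\<exists>p. {z, p} \<in> A \<and> (p, x) \<in> linked {\<delta> \<in> A. z \<notin> \<delta>}"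
      using linked_first_edge[of z x A] assms(4) that by blast
    then show "{z, par z} \<in> A" "(par z, x) \<in> linked {\<delta> \<in> A. z \<notin> \<delta>}"
      unfolding par_def by (metis (mono_tags, lifting) someI_ex)+
  qed
  have "inj_on (\<lambda>z. {z, par z}) (C - {x})"
  proof (rule inj_onI, rule ccontr)
    fix z w
    assume z: "z \<in> C - {x}" and w: "w \<in> C - {x}" and eq: "{z, par z} = {w, par w}" and ne: "z \<noteq> w"
    then have pz: "par z = w" and pw: "par w = z" by (auto simp: doubleton_eq_iff)
    have 1: "linked {\<delta> \<in> A. z \<notin> \<delta>} \<subseteq> linked (A - {{z, w}})"
      and 2: "linked {\<delta> \<in> A. w \<notin> \<delta>} \<subseteq> linked (A - {{z, w}})"
      by (intro linked_mono; auto)+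
    have "(w, x) \<in> linked (A - {{z, w}})" using par(2)[OF z] pz 1 by auto
    moreover have "(z, x) \<in> linked (A - {{z, w}})" using par(2)[OF w] pw 2 by auto
    ultimately have "(z, w) \<in> linked (A - {{z, w}})" using linked_trans[of z x _ w] linked_sym[of w x] by simp
    then show False using assms(1) par(1)[OF z] pz by (auto simp: bridges_def)
  qed
  moreover have "(\<lambda>z. {z, par z}) ` (C - {x}) \<subseteq> {\<delta> \<in> A. \<delta> \<subseteq> C}"
    using par(1) assms(5) by blast
  ultimately have "card (C - {x}) \<le> card {\<delta> \<in> A. \<delta> \<subseteq> C}"
    using assms(2) by (intro card_inj_on_le) auto
  then show ?thesis using assms(3) by (cases "finite C") auto
qed

text \<open>Map every edge to its child end, the one that its deletion separates from
  \<open>r\<close>; the root is never a child end. Paths to \<open>r\<close> may leave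
  \<open>C\<close>: in the application \<open>C\<close> is a side of one tree and \<open>T\<close>
  is the other tree.\<close>

lemma card_edges_within_less:
  assumes br: "bridges T" and "finite C" "r \<in> C"
    and con: "\<And>z. z \<in> C \<Longrightarrow> (z, r) \<in> linked T"
    and edge: "\<And>\<delta>. \<delta> \<in> T \<Longrightarrow> \<exists>a b. \<delta> = {a, b}"
  shows "card {\<delta> \<in> T. \<delta> \<subseteq> C} < card C"
proof -
  define c where "c \<delta> = (SOME z. z \<in> \<delta> \<and> (z, r) \<notin> linked (T - {\<delta>}))" for \<delta>
  have c: "c \<delta> \<in> \<delta>" "(c \<delta>, r) \<notin> linked (T - {\<delta>})" if \<delta>: "\<delta> \<in> T" for \<delta>
  proof -
    obtain a b where ab: "\<delta> = {a, b}" using edge[OF \<delta>] by blast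
    have "(a, b) \<notin> linked (T - {\<delta>})" using br that ab by (auto simp: bridges_def)
    then have "(a, r) \<notin> linked (T - {\<delta>}) \<or> (b, r) \<notin> linked (T - {\<delta>})"
      using linked_trans[of a r "T - {\<delta>}" b] linked_sym[of b r "T - {\<delta>}"] by blast
    then have "\<exists>z. z \<in> \<delta> \<and> (z, r) \<notin> linked (T - {\<delta>})" using ab by auto
    then show "c \<delta> \<in> \<delta>" "(c \<delta>, r) \<notin> linked (T - {\<delta>})"
      unfolding c_def by (metis (mono_tags, lifting) someI_ex)+
  qed
  have "inj_on c {\<delta> \<in> T. \<delta> \<subseteq> C}"
  proof (rule inj_onI)
    fix \<delta> \<delta>'
    assume d: "\<delta> \<in> {\<delta> \<in> T. \<delta> \<subseteq> C}" "\<delta>' \<in> {\<delta> \<in> T. \<delta> \<subseteq> C}" and eq: "c \<delta> = c \<delta>'"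
    define z where "z = c \<delta>"
    have zC: "z \<in> C" using c(1)[of \<delta>] d z_def by auto
    have "z \<noteq> r" using c(2)[of \<delta>] d z_def by auto
    then obtain p where p: "{z, p} \<in> T" "(p, r) \<in> linked {\<delta> \<in> T. z \<notin> \<delta>}"
      using linked_first_edge[of z r T] con zC by blast
    \<comment> \<open>\<open>{z, p}\<close> starts a route from \<open>z\<close> to \<open>r\<close>
      that does not return to \<open>z\<close>, so deleting any other edge at \<open>z\<close>
      leaves this route intact.\<close>
    have *: "\<gamma> = {z, p}" if "\<gamma> \<in> T" "c \<gamma> = z" for \<gamma>
    proof (rule ccontr)
      assume "\<gamma> \<noteq> {z, p}"
      then have "(z, p) \<in> linked (T - {\<gamma>})" using p(1) by (auto intro: linked_edge)
      moreover have "linked {\<delta> \<in> T. z \<notin> \<delta>} \<subseteq> linked (T - {\<gamma>})"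
        using c(1)[OF that(1)] that(2) by (intro linked_mono) auto
      ultimately have "(z, r) \<in> linked (T - {\<gamma>})" using p(2) linked_trans[of z p] by blast
      then show False using c(2)[OF that(1)] that(2) by simp
    qed
    show "\<delta> = \<delta>'" using *[of \<delta>] *[of \<delta>'] d eq z_def by auto
  qed
  moreover have "c ` {\<delta> \<in> T. \<delta> \<subseteq> C} \<subseteq> C - {r}"
    using c by fastforce
  ultimately have "card {\<delta> \<in> T. \<delta> \<subseteq> C} \<le> card (C - {r})"
    using assms(2) by (intro card_inj_on_le) auto
  also have "\<dots> < card C" using assms(2,3) by (intro psubset_card_mono) auto
  finally show ?thesis .
qed

lemma binary_weight_less:
  fixes w w' :: "nat \<Rightarrow> bool"
  assumes "n < K" "\<And>k. k < n \<Longrightarrow> w k = w' k" "\<not> w n" "w' n"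
  shows "(\<Sum>k<K. of_bool (w k) * 2 ^ (K - k)) < (\<Sum>k<K. of_bool (w' k) * (2 ^ (K - k) :: nat))"
proof -
  have tail: "(\<Sum>k\<in>{Suc n..<K}. 2 ^ (K - k)) < (2 ^ (K - n) :: nat)"
  proof -
    \<comment> \<open>The smallest power in the sum is \<open>2 ^ 1\<close>, at
      \<open>k = K - 1\<close>, so the geometric sum falls short of the next power by 2.\<close>
    have "(\<Sum>k\<in>{m..<K}. 2 ^ (K - k)) + 2 = (2 ^ (K + 1 - m) :: nat)" if "m \<le> K" for m
      using that
    proof (induction rule: inc_induct)
      case (step m)
      then have "(\<Sum>k\<in>{m..<K}. 2 ^ (K - k)) = (2 ^ (K - m) :: nat) + (\<Sum>k\<in>{Suc m..<K}. 2 ^ (K - k))"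
        by (subst sum.atLeast_Suc_lessThan) auto
      moreover have "(2::nat) ^ (K + 1 - m) = 2 ^ (K - m) + 2 ^ (K + 1 - Suc m)"
        using step by (simp add: Suc_diff_le)
      ultimately show ?case using step by linarith
    qed auto
    from this[of "Suc n"] assms(1) show ?thesis by simp
  qed
  have split: "(\<Sum>k<K. g k) = (\<Sum>k<n. g k) + g n + (\<Sum>k\<in>{Suc n..<K}. g k)" for g :: "nat \<Rightarrow> nat"
  proof -
    have "(\<Sum>k<K. g k) = (\<Sum>k<Suc n. g k) + (\<Sum>k\<in>{Suc n..<K}. g k)"
      using assms(1) by (metis Suc_leI lessThan_atLeast0 sum.atLeastLessThan_concat zero_le)
    then show ?thesis by simp
  qed
  have "(\<Sum>k<n. of_bool (w k) * 2 ^ (K - k)) = (\<Sum>k<n. of_bool (w' k) * (2 ^ (K - k) :: nat))"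
    using assms(2) by (intro sum.cong) auto
  moreover have "(\<Sum>k\<in>{Suc n..<K}. of_bool (w k) * 2 ^ (K - k)) \<le> (\<Sum>k\<in>{Suc n..<K}. (2 ^ (K - k) :: nat))"
    by (intro sum_mono) auto
  ultimately show ?thesis
    using tail assms(3,4) split[of "\<lambda>k. of_bool (w k) * 2 ^ (K - k)"]
      split[of "\<lambda>k. of_bool (w' k) * 2 ^ (K - k)"] by simp
qed

section \<open>Tours of spanning trees\<close>

declare tour_step.simps [simp del]

locale ribbon_bigraph =
  fixes N M :: "'n set" and F :: "'n set set" and rot :: "'n \<Rightarrow> 'n set \<Rightarrow> 'n set"
    and s :: "'n \<times> 'n set"
  assumes finite_N: "finite N"
    and bip: "\<delta> \<in> F \<Longrightarrow> \<exists>x\<in>N \<inter> M. \<exists>y\<in>N - M. \<delta> = {x, y}"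
    and ribbon: "ribbon_structure N F rot"
    and start: "snd s \<in> F" "fst s \<in> snd s"
begin

definition half_edges :: "('n \<times> 'n set) set" where
  "half_edges = {(x, \<delta>). \<delta> \<in> F \<and> x \<in> \<delta>}"

abbreviation \<phi> :: "'n set set \<Rightarrow> 'n \<times> 'n set \<Rightarrow> 'n \<times> 'n set" where
  "\<phi> T \<equiv> tour_step rot T"

definition at :: "'n set set \<Rightarrow> nat \<Rightarrow> 'n \<times> 'n set" where
  "at T n = (\<phi> T ^^ n) s"

text \<open>For a tree this is the index in \<open>tour\<close>, by \<open>visit_unique\<close>, so
  visiting times can replace list positions.\<close>

definition visit :: "'n set set \<Rightarrow> 'n \<times> 'n set \<Rightarrow> nat" where
  "visit T h = (LEAST n. at T n = h)"

lemma at_0 [simp]: "at T 0 = s" and at_Suc: "at T (Suc n) = \<phi> T (at T n)"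
  by (simp_all add: at_def)

lemma edgeD: "{x, y} \<in> F \<Longrightarrow> x \<in> N \<and> y \<in> N \<and> x \<noteq> y \<and> (x \<in> M \<longleftrightarrow> y \<notin> M)"
  by (drule bip) (auto simp: doubleton_eq_iff)

lemma edge_at: "\<delta> \<in> F \<Longrightarrow> x \<in> \<delta> \<Longrightarrow> \<exists>y. \<delta> = {x, y}"
  by (drule bip) auto

lemma other_end [simp]: "other_end x {x, y} = y"
  by (auto simp: other_end_def doubleton_eq_iff)

lemma other_end' [simp]: "other_end y {x, y} = x"
  by (auto simp: other_end_def doubleton_eq_iff)

lemma finite_F: "finite F"
  by (rule finite_subset[of _ "Pow N"]) (use bip finite_N in \<open>blast, simp\<close>)

lemma finite_half_edges: "finite half_edges"
  by (rule finite_subset[of _ "N \<times> F"])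
    (use bip finite_N finite_F in \<open>fastforce simp: half_edges_def, simp\<close>)

lemma half_edge_node: "(x, \<delta>) \<in> half_edges \<Longrightarrow> x \<in> N"
  unfolding half_edges_def using bip by fastforce

lemma start_half_edge: "s \<in> half_edges"
  using start by (cases s) (auto simp: half_edges_def)

lemma rot_half_edge: "(x, \<delta>) \<in> half_edges \<Longrightarrow> (x, rot x \<delta>) \<in> half_edges"
proof -
  assume h: "(x, \<delta>) \<in> half_edges"
  have "rot x permutes incident F x"
    using ribbon half_edge_node[OF h] by (auto simp: ribbon_structure_def)
  then have "rot x \<delta> \<in> incident F x"
    using h permutes_in_image[of "rot x" "incident F x" \<delta>]
    by (auto simp: incident_def half_edges_def)
  then show ?thesis by (auto simp: incident_def half_edges_def)
qed

lemma \<phi>_half_edge: "h \<in> half_edges \<Longrightarrow> \<phi> T h \<in> half_edges"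
proof -
  assume h: "h \<in> half_edges"
  obtain x \<delta> where x: "h = (x, \<delta>)" by force
  then obtain y where y: "\<delta> = {x, y}" using h edge_at by (auto simp: half_edges_def)
  then have "(y, \<delta>) \<in> half_edges" using x h by (auto simp: half_edges_def)
  then show ?thesis using x y h rot_half_edge by (auto simp: tour_step.simps)
qed

lemma at_half_edge: "at T n \<in> half_edges"
  by (induction n) (auto simp: at_Suc start_half_edge \<phi>_half_edge)

text \<open>A step can be undone: the new node \<open>u\<close> and injectivity of
  \<open>rot u\<close> determine the edge, and its membership in \<open>T\<close> tells whether the
  node has changed.\<close>

lemma \<phi>_inj: "inj_on (\<phi> T) half_edges"
proof (rule inj_onI)
  fix h h'
  assume h: "h \<in> half_edges" "h' \<in> half_edges" and eq: "\<phi> T h = \<phi> T h'"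
  obtain x \<delta> x' \<delta>' where x: "h = (x, \<delta>)" "h' = (x', \<delta>')" by force
  obtain y where y: "\<delta> = {x, y}" using h x edge_at by (auto simp: half_edges_def)
  obtain y' where y': "\<delta>' = {x', y'}" using h x edge_at by (auto simp: half_edges_def)
  define u where "u = (if \<delta> \<in> T then y else x)"
  define u' where "u' = (if \<delta>' \<in> T then y' else x')"
  have "\<phi> T h = (u, rot u \<delta>)" "\<phi> T h' = (u', rot u' \<delta>')"
    using x y y' by (auto simp: u_def u'_def tour_step.simps)
  then have uu: "u = u'" "rot u \<delta> = rot u \<delta>'" using eq by auto
  have "(u, \<delta>) \<in> half_edges" using h x y by (auto simp: u_def half_edges_def)
  then have "inj (rot u)"
    using ribbon half_edge_node permutes_inj unfolding ribbon_structure_def by metis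
  then have "\<delta> = \<delta>'" using uu by (auto dest: injD)
  moreover have "x = (if \<delta> \<in> T then other_end u \<delta> else u)" by (simp add: u_def y)
  moreover have "x' = (if \<delta>' \<in> T then other_end u' \<delta>' else u')" by (simp add: u'_def y')
  ultimately show "h = h'" using uu x by simp
qed

lemma funpow_half_edge: "h \<in> half_edges \<Longrightarrow> (\<phi> T ^^ n) h \<in> half_edges"
  by (induction n) (auto simp: \<phi>_half_edge)

lemma funpow_inj: "inj_on (\<phi> T ^^ n) half_edges"
proof (induction n)
  case (Suc n)
  have "(\<phi> T ^^ n) ` half_edges \<subseteq> half_edges" using funpow_half_edge by blast
  then show ?case
    using comp_inj_on[OF Suc inj_on_subset[OF \<phi>_inj[of T]]] by (simp add: comp_def)
qed simp

lemma funpow_diff: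
  assumes "h \<in> half_edges" "(\<phi> T ^^ i) h = (\<phi> T ^^ j) h" "i < j"
  shows "(\<phi> T ^^ (j - i)) h = h"
proof -
  have "(\<phi> T ^^ i) ((\<phi> T ^^ (j - i)) h) = (\<phi> T ^^ i) h"
    using assms(2,3) by (metis comp_apply funpow_add le_add_diff_inverse less_imp_le)
  then show ?thesis
    using inj_onD[OF funpow_inj] funpow_half_edge assms(1) by metis
qed

lemma period:
  assumes "h \<in> half_edges"
  shows "\<exists>n>0. (\<phi> T ^^ n) h = h"
proof -
  have "\<not> inj (\<lambda>i. (\<phi> T ^^ i) h)"
  proof
    assume "inj (\<lambda>i. (\<phi> T ^^ i) h)"
    then have "infinite (range (\<lambda>i. (\<phi> T ^^ i) h))" using finite_imageD by blast
    moreover have "range (\<lambda>i. (\<phi> T ^^ i) h) \<subseteq> half_edges" using funpow_half_edge[OF assms] by blast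
    ultimately show False using finite_half_edges finite_subset by blast
  qed
  then obtain i j where "i \<noteq> j" and ij: "(\<phi> T ^^ i) h = (\<phi> T ^^ j) h"
    by (auto simp: inj_def)
  then consider "i < j" | "j < i" by linarith
  then show ?thesis
    using funpow_diff[OF assms ij] funpow_diff[OF assms ij[symmetric]] zero_less_diff by cases blast+
qed

lemma tour_length: "0 < tour_length rot T s" "at T (tour_length rot T s) = s"
proof -
  have "\<exists>n. 0 < n \<and> (\<phi> T ^^ n) s = s" using period[OF start_half_edge] by blast
  from LeastI_ex[OF this] show "0 < tour_length rot T s" "at T (tour_length rot T s) = s"
    by (auto simp: tour_length_def at_def)
qed

lemma at_mod: "at T (n mod tour_length rot T s) = at T n"
  using tour_length(2)[of T] unfolding at_def by (rule funpow_mod_eq)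

lemma at_eq_imp:
  assumes "at T i = at T j" "i < tour_length rot T s" "j < tour_length rot T s"
  shows "i = j"
proof -
  have "\<not> i < j" if "at T i = at T j" "j < tour_length rot T s" for i j
  proof
    assume "i < j"
    then have "(\<phi> T ^^ (j - i)) s = s"
      using funpow_diff[OF start_half_edge] that(1) unfolding at_def by blast
    then have "tour_length rot T s \<le> j - i"
      unfolding tour_length_def using \<open>i < j\<close> by (intro Least_le) auto
    then show False using that(2) \<open>i < j\<close> by linarith
  qed
  from this[of i j] this[of j i] show ?thesis using assms by fastforce
qed

text \<open>A bound independent of \<open>T\<close>, so that \<open>weight\<close> can use the same
  number of digits for all trees.\<close>

lemma tour_length_le: "tour_length rot T s \<le> card half_edges"
proof -
  have "inj_on (at T) {..<tour_length rot T s}" by (auto intro!: inj_onI dest: at_eq_imp)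
  then have "card {..<tour_length rot T s} \<le> card half_edges"
    using at_half_edge finite_half_edges by (intro card_inj_on_le) auto
  then show ?thesis by simp
qed

section \<open>Tours of trees: completeness, and the two sides of a tree edge\<close>

definition tree :: "'n set set \<Rightarrow> bool" where
  "tree T \<longleftrightarrow> T \<subseteq> F \<and> bridges T \<and> (\<forall>x\<in>N. \<forall>y\<in>N. (x, y) \<in> linked T)"

lemma N_nonempty: "N \<noteq> {}"
  using start bip by blast

lemma tree_iff: "is_spanning_tree N F T \<longleftrightarrow> tree T"
proof -
  have "{x} \<notin> F" for x using bip by (fastforce simp: doubleton_eq_iff)
  then show ?thesis
    using acyclic_imp_bridges[of T] bridges_imp_acyclic[of T] N_nonempty
    unfolding is_spanning_tree_def tree_def connected_graph_def linked_def by blast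
qed

text \<open>A step stays at its node or crosses the current tree edge, so only steps from the two
  half-edges of \<open>{x, y}\<close> can change sides.\<close>

lemma step_linked:
  assumes "h \<in> half_edges" "h \<noteq> (x, {x, y})" "h \<noteq> (y, {x, y})"
  shows "(fst h, fst (\<phi> T h)) \<in> linked (T - {{x, y}})"
proof -
  obtain u \<delta> where u: "h = (u, \<delta>)" by force
  then obtain w where w: "\<delta> = {u, w}" using edge_at assms(1) by (auto simp: half_edges_def)
  have "\<delta> \<noteq> {x, y}" using assms u w by (auto simp: doubleton_eq_iff)
  then show ?thesis using u w by (auto intro: linked_edge simp: tour_step.simps)
qed

text \<open>
  Crossing a tree edge leads to the other side of that bridge, and the tour, being periodic, can
  only come back by crossing the same edge in the opposite direction.
\<close>

lemma visits_both_ends: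
  assumes T: "tree T" and xy: "{x, y} \<in> T" and n: "at T n = (x, {x, y})"
  shows "\<exists>m. at T m = (y, {x, y})"
proof (rule ccontr)
  assume no: "\<nexists>m. at T m = (y, {x, y})"
  let ?A = "T - {{x, y}}"
  have br: "(x, y) \<notin> linked ?A" using T xy by (auto simp: tree_def bridges_def)
  obtain m where m: "m > 0" "(\<phi> T ^^ m) (x, {x, y}) = (x, {x, y})"
    using period[OF at_half_edge] n by metis
  have per: "at T (m + n) = (x, {x, y})" using m n by (simp add: at_def funpow_add)
  \<comment> \<open>After the crossing the tour stays on the side of \<open>y\<close>:
    \<open>(x, {x, y})\<close> cannot occur there because \<open>x\<close> is on the other side, and
    \<open>(y, {x, y})\<close> is excluded by assumption.\<close>
  have "(fst (at T (Suc k + n)), y) \<in> linked ?A" for k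
  proof (induction k)
    case 0
    show ?case using n xy by (simp add: at_Suc tour_step.simps)
  next
    case (Suc k)
    have "at T (Suc k + n) \<noteq> (x, {x, y})" using Suc br by auto
    moreover have "at T (Suc k + n) \<noteq> (y, {x, y})" using no by blast
    ultimately have "(fst (at T (Suc k + n)), fst (at T (Suc (Suc k + n)))) \<in> linked ?A"
      using step_linked[OF at_half_edge, of T "Suc k + n" x y T] by (simp add: at_Suc)
    from linked_trans[OF linked_sym[OF this] Suc] show ?case by simp
  qed
  from this[of "m - 1"] have "(fst (at T (m + n)), y) \<in> linked ?A" using m(1) by simp
  then show False using per br by simp
qed

lemma visits_all:
  assumes T: "tree T" and h: "h \<in> half_edges"
  shows "\<exists>n. at T n = h"
proof -
  define W where "W = range (at T)"
  have TF: "T \<subseteq> F" using T by (simp add: tree_def)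
  have cross: "(y, {x, y}) \<in> W" if "(x, {x, y}) \<in> W" "{x, y} \<in> T" for x y
    using visits_both_ends[OF T that(2)] that(1) unfolding W_def by (metis rangeE rangeI)
  have \<phi>W: "\<phi> T h \<in> W" if "h \<in> W" for h
    using that unfolding W_def by (auto simp: at_Suc[symmetric])
  \<comment> \<open>At a tree edge \<open>{x, y}\<close> the tour leaves \<open>x\<close>, but it
    also visits \<open>(y, {x, y})\<close>, and the step from there returns to \<open>x\<close> and
    rotates.\<close>
  have rotO: "(x, rot x \<delta>) \<in> W" if "(x, \<delta>) \<in> W" for x \<delta>
  proof -
    have "(x, \<delta>) \<in> half_edges" using that at_half_edge by (auto simp: W_def)
    then obtain y where y: "\<delta> = {x, y}" using edge_at by (auto simp: half_edges_def)
    show ?thesis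
    proof (cases "\<delta> \<in> T")
      case True
      then show ?thesis using \<phi>W[OF cross[of x y]] that y by (simp add: tour_step.simps)
    next
      case False
      then show ?thesis using \<phi>W[OF that] by (simp add: tour_step.simps)
    qed
  qed
  have all: "(x, \<delta>') \<in> W" if "(x, \<delta>) \<in> W" "\<delta>' \<in> F" "x \<in> \<delta>'" for x \<delta> \<delta>'
  proof -
    have "(x, \<delta>) \<in> half_edges" using that at_half_edge by (auto simp: W_def)
    then have "x \<in> N" "\<delta> \<in> incident F x"
      by (auto simp: half_edges_def incident_def intro: half_edge_node)
    then have "orbit (rot x) \<delta> = incident F x"
      using ribbon orbit_cyclic_eq3 unfolding ribbon_structure_def by (metis empty_iff)
    then have "\<delta>' \<in> orbit (rot x) \<delta>" using that by (auto simp: incident_def)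
    then show ?thesis by induction (use that(1) rotO in auto)
  qed
  have reach: "\<forall>\<delta>\<in>F. z \<in> \<delta> \<longrightarrow> (z, \<delta>) \<in> W" if "z \<in> N" for z
  proof -
    have s: "(fst s, snd s) \<in> W" unfolding W_def using rangeI[of "at T" 0] by simp
    have "(z, fst s) \<in> linked T" using T that half_edge_node[of "fst s" "snd s"] start_half_edge
      by (auto simp: tree_def)
    then show ?thesis
    proof (induction rule: linked_induct)
      case refl
      show ?case using all s by blast
    next
      case (step u w)
      then have "(w, {u, w}) \<in> W" using TF by blast
      then have "(u, {u, w}) \<in> W" using cross[of w u] step.hyps by (simp add: insert_commute)
      then show ?case using all by blast
    qed
  qed
  obtain x \<delta> where x: "h = (x, \<delta>)" by force
  then have "h \<in> W" using reach[of x] half_edge_node[of x \<delta>] h by (auto simp: half_edges_def)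
  then show ?thesis by (auto simp: W_def)
qed

lemma at_visit:
  assumes "tree T" "h \<in> half_edges"
  shows "at T (visit T h) = h"
  unfolding visit_def using visits_all[OF assms] by (rule LeastI_ex)

lemma visit_le: "at T n = h \<Longrightarrow> visit T h \<le> n"
  unfolding visit_def by (rule Least_le)

lemma visit_less_length:
  assumes "tree T" "h \<in> half_edges"
  shows "visit T h < tour_length rot T s"
proof -
  have "at T (visit T h mod tour_length rot T s) = h" using at_mod at_visit assms by simp
  then have "visit T h \<le> visit T h mod tour_length rot T s" by (rule visit_le)
  then show ?thesis using tour_length(1)[of T] mod_less_divisor le_less_trans by blast
qed

lemma visit_unique:
  assumes "tree T" "at T n = h" "n < tour_length rot T s"
  shows "n = visit T h"
proof -
  have "h \<in> half_edges" using at_half_edge assms(2) by metis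
  then show ?thesis
    using assms at_visit[of T h] visit_less_length[of T h] by (intro at_eq_imp[of T]) simp_all
qed

lemma precedes_iff:
  assumes T: "tree T" and h: "h \<in> half_edges" "h' \<in> half_edges"
  shows "precedes (tour rot T s) h h' \<longleftrightarrow> visit T h < visit T h'"
proof -
  have len: "length (tour rot T s) = tour_length rot T s" by (simp add: tour_def)
  have nth: "tour rot T s ! i = at T i" if "i < tour_length rot T s" for i
    using that by (simp add: tour_def at_def)
  show ?thesis
  proof
    assume "precedes (tour rot T s) h h'"
    then obtain i j where ij: "i < j" "j < tour_length rot T s" "at T i = h" "at T j = h'"
      unfolding precedes_def len using nth by (metis order.strict_trans)
    then have "i = visit T h" "j = visit T h'" using visit_unique[OF T] by auto
    then show "visit T h < visit T h'" using ij by simp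
  next
    assume "visit T h < visit T h'"
    then show "precedes (tour rot T s) h h'"
      unfolding precedes_def len using nth visit_less_length[OF T] at_visit[OF T] h
      by (metis order.strict_trans)
  qed
qed

text \<open>The half-open range matters: the step from position \<open>j\<close> is not part of the
  segment, so \<open>j\<close> itself may be a crossing.\<close>

lemma tour_segment_linked:
  assumes T: "tree T" and "i \<le> j" "j < tour_length rot T s"
    and "visit T (x, {x, y}) \<notin> {i..<j}" "visit T (y, {x, y}) \<notin> {i..<j}"
  shows "(fst (at T i), fst (at T j)) \<in> linked (T - {{x, y}})"
  using assms(2-5)
proof (induction rule: dec_induct)
  case (step j)
  have j: "j < tour_length rot T s" using step.prems by simp
  have "at T j \<noteq> (x, {x, y})" "at T j \<noteq> (y, {x, y})"
    using step.prems(2,3) step.hyps visit_unique[OF T _ j] by auto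
  then have "(fst (at T j), fst (at T (Suc j))) \<in> linked (T - {{x, y}})"
    using step_linked[OF at_half_edge, of T j x y T] by (simp add: at_Suc)
  moreover have "(fst (at T i), fst (at T j)) \<in> linked (T - {{x, y}})"
    using step by auto
  ultimately show ?case by (blast intro: linked_trans)
qed simp

text \<open>The tour starts on the side of \<open>x\<close>, enters the side of \<open>y\<close> by
  the step from \<open>(x, {x, y})\<close> and leaves it by the step from
  \<open>(y, {x, y})\<close>. At these positions the current node is still \<open>x\<close> and
  \<open>y\<close>, respectively, so the lower bound is strict and the upper one is not.\<close>

lemma visit_interval:
  assumes T: "tree T" and xy: "{x, y} \<in> T"
    and first: "visit T (x, {x, y}) < visit T (y, {x, y})"
    and z: "(z, \<delta>) \<in> half_edges"
  shows "(z, y) \<in> linked (T - {{x, y}}) \<longleftrightarrow>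
    visit T (x, {x, y}) < visit T (z, \<delta>) \<and> visit T (z, \<delta>) \<le> visit T (y, {x, y})"
proof -
  let ?A = "T - {{x, y}}" and ?n = "visit T (z, \<delta>)" and ?a = "visit T (x, {x, y})"
    and ?b = "visit T (y, {x, y})" and ?L = "tour_length rot T s"
  have br: "(x, y) \<notin> linked ?A" using T xy by (auto simp: tree_def bridges_def)
  have h: "(x, {x, y}) \<in> half_edges" "(y, {x, y}) \<in> half_edges"
    using T xy by (auto simp: tree_def half_edges_def)
  have at: "at T ?n = (z, \<delta>)" "at T ?a = (x, {x, y})" "at T ?b = (y, {x, y})"
    using at_visit[OF T] z h by auto
  have L: "?n < ?L" "?a < ?L" "?b < ?L" using visit_less_length[OF T] z h by auto
  have Suc: "fst (at T (Suc ?a)) = y" "fst (at T (Suc ?b)) = x"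
    using xy by (auto simp: at_Suc at tour_step.simps)
  consider "?n \<le> ?a" | "?a < ?n" "?n \<le> ?b" | "?b < ?n" by linarith
  then show ?thesis
  proof cases
    case 1
    then have "(z, x) \<in> linked ?A"
      using tour_segment_linked[OF T 1, of x y] L first at by auto
    then show ?thesis using 1 br linked_trans[of x z ?A y] linked_sym[of z x ?A] by auto
  next
    case 2
    then have "(y, z) \<in> linked ?A"
      using tour_segment_linked[OF T, of "Suc ?a" ?n x y] L first at Suc by auto
    then show ?thesis using 2 linked_sym by auto
  next
    case 3
    then have "(x, z) \<in> linked ?A"
      using tour_segment_linked[OF T, of "Suc ?b" ?n x y] L first at Suc by auto
    then show ?thesis using 3 br linked_trans[of x z ?A y] by auto
  qed
qed

section \<open>Uniqueness and existence of Jaeger trees\<close>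

definition jaeger :: "'n set set \<Rightarrow> bool" where
  "jaeger T \<longleftrightarrow> tree T \<and>
     (\<forall>x y. {x, y} \<in> F - T \<longrightarrow> x \<in> M \<longrightarrow> visit T (x, {x, y}) < visit T (y, {x, y}))"

lemma jaeger_iff:
  "jaeger T \<longleftrightarrow> is_spanning_tree N F T \<and> (\<forall>\<epsilon>\<in>F - T. \<forall>x\<in>M. x \<in> \<epsilon> \<longrightarrow> cut_at rot s T \<epsilon> x)"
proof (cases "tree T")
  case True
  have *: "cut_at rot s T {x, y} x \<longleftrightarrow> visit T (x, {x, y}) < visit T (y, {x, y})"
    if "{x, y} \<in> F" for x y
    using precedes_iff[OF True] that by (simp add: cut_at_def half_edges_def)
  show ?thesis
  proof
    assume j: "jaeger T"
    have "cut_at rot s T \<epsilon> x" if \<epsilon>: "\<epsilon> \<in> F - T" "x \<in> M" "x \<in> \<epsilon>" for \<epsilon> x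
    proof -
      obtain y where "\<epsilon> = {x, y}" using \<epsilon> edge_at by blast
      then show ?thesis using j \<epsilon> * by (auto simp: jaeger_def)
    qed
    then show "is_spanning_tree N F T \<and> (\<forall>\<epsilon>\<in>F - T. \<forall>x\<in>M. x \<in> \<epsilon> \<longrightarrow> cut_at rot s T \<epsilon> x)"
      using True by (simp add: tree_iff)
  next
    assume "is_spanning_tree N F T \<and> (\<forall>\<epsilon>\<in>F - T. \<forall>x\<in>M. x \<in> \<epsilon> \<longrightarrow> cut_at rot s T \<epsilon> x)"
    then show "jaeger T" unfolding jaeger_def using True * by blast
  qed
next
  case False
  then show ?thesis by (simp add: jaeger_def tree_iff)
qed

text \<open>Every edge has exactly one end in \<open>M\<close>, so no edge is counted twice. Through
  this the count in the uniqueness argument depends on emerald degrees alone.\<close>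

lemma card_edges_by_degree:
  assumes "A \<subseteq> F" "C \<subseteq> N"
  shows "card {\<delta> \<in> A. \<exists>u\<in>C \<inter> M. u \<in> \<delta>} = (\<Sum>u\<in>C \<inter> M. node_degree A u)"
proof -
  have "card (\<Union>u\<in>C \<inter> M. incident A u) = (\<Sum>u\<in>C \<inter> M. card (incident A u))"
  proof (rule card_UN_disjoint)
    show "finite (C \<inter> M)" using assms(2) finite_N finite_subset by blast
    show "\<forall>u\<in>C \<inter> M. finite (incident A u)"
      using assms(1) finite_F by (auto simp: incident_def intro: finite_subset)
    show "\<forall>u\<in>C \<inter> M. \<forall>w\<in>C \<inter> M. u \<noteq> w \<longrightarrow> incident A u \<inter> incident A w = {}"
      using assms(1) bip by (fastforce simp: incident_def)
  qed
  moreover have "(\<Union>u\<in>C \<inter> M. incident A u) = {\<delta> \<in> A. \<exists>u\<in>C \<inter> M. u \<in> \<delta>}"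
    by (auto simp: incident_def)
  ultimately show ?thesis by (simp add: node_degree_def)
qed

text \<open>
  At the first disagreement of the tours, \<open>T\<close> keeps the edge \<open>{x, y}\<close> and \<open>T'\<close> cuts it at its
  emerald end \<open>x\<close>. Let \<open>C\<close> be the side of \<open>x\<close> in \<open>T - {x, y}\<close>. No edge of \<open>T'\<close> has its emerald end
  in \<open>C\<close> and its violet end outside, so \<open>T'\<close> has fewer than \<open>card C\<close> edges with emerald end in \<open>C\<close>;
  but \<open>T\<close> has at least \<open>card C\<close> of them.
\<close>

lemma first_difference_absurd:
  assumes jT: "jaeger T" and jT': "jaeger T'"
    and deg: "\<And>u. u \<in> N \<inter> M \<Longrightarrow> node_degree T u = node_degree T' u"
    and same: "\<And>k. k \<le> n \<Longrightarrow> at T k = at T' k"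
    and before: "\<And>k. k < n \<Longrightarrow> snd (at T k) \<in> T \<longleftrightarrow> snd (at T k) \<in> T'"
    and here: "snd (at T n) \<in> T" "snd (at T n) \<notin> T'"
  shows False
proof -
  have T: "tree T" and T': "tree T'" using jT jT' by (auto simp: jaeger_def)
  have TF: "T \<subseteq> F" "T' \<subseteq> F" using T T' by (auto simp: tree_def)
  obtain x y where xy: "at T n = (x, {x, y})"
    using at_half_edge[of T n] edge_at by (cases "at T n") (auto simp: half_edges_def)
  let ?\<epsilon> = "{x, y}" and ?A = "T - {{x, y}}"
  have \<epsilon>: "?\<epsilon> \<in> T" "?\<epsilon> \<notin> T'" "?\<epsilon> \<in> F" using here xy TF by auto
  have h: "(x, ?\<epsilon>) \<in> half_edges" "(y, ?\<epsilon>) \<in> half_edges" using \<epsilon> by (auto simp: half_edges_def)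
  have xyN: "x \<in> N" "y \<in> N" "x \<noteq> y" "x \<in> M \<longleftrightarrow> y \<notin> M" using edgeD[OF \<epsilon>(3)] by auto
  have early: "visit T (z, \<delta>) = n" "z = x" "\<delta> = ?\<epsilon>"
    if "(z, \<delta>) \<in> half_edges" "visit T (z, \<delta>) \<le> n" "\<delta> \<in> T \<longleftrightarrow> \<delta> \<notin> T'" for z \<delta>
  proof -
    have "at T (visit T (z, \<delta>)) = (z, \<delta>)" using at_visit[OF T that(1)] .
    then show n: "visit T (z, \<delta>) = n" using before[of "visit T (z, \<delta>)"] that by fastforce
    then show "z = x" "\<delta> = ?\<epsilon>" using at_visit[OF T that(1)] xy by auto
  qed
  have xM: "x \<in> M"
  proof (rule ccontr)
    assume "x \<notin> M"
    then have "visit T' (y, ?\<epsilon>) < visit T' (x, ?\<epsilon>)"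
      using jT' \<epsilon> xyN unfolding jaeger_def insert_commute[of x y] by blast
    also have "visit T' (x, ?\<epsilon>) \<le> n" using same[of n] xy by (intro visit_le) simp
    finally have "visit T' (y, ?\<epsilon>) < n" .
    then have "at T (visit T' (y, ?\<epsilon>)) = (y, ?\<epsilon>)"
      using same at_visit[OF T' h(2)] by simp
    then have "visit T (y, ?\<epsilon>) \<le> n" using visit_le \<open>visit T' (y, ?\<epsilon>) < n\<close> by fastforce
    then show False using early[OF h(2)] \<epsilon> xyN by simp
  qed
  have vx: "visit T (x, ?\<epsilon>) = n" using early(1)[OF h(1) visit_le[OF xy]] \<epsilon> by simp
  have vy: "n < visit T (y, ?\<epsilon>)"
  proof (rule ccontr)
    assume "\<not> n < visit T (y, ?\<epsilon>)"
    then have "visit T (y, ?\<epsilon>) \<le> n" by simp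
    then show False using early(2)[OF h(2)] \<epsilon> xyN by simp
  qed
  have interval: "(z, y) \<in> linked ?A \<longleftrightarrow> n < visit T (z, \<delta>) \<and> visit T (z, \<delta>) \<le> visit T (y, ?\<epsilon>)"
    if "(z, \<delta>) \<in> half_edges" for z \<delta>
    using visit_interval[OF T \<epsilon>(1) _ that] vx vy by simp
  define C where "C = {z \<in> N. (z, y) \<notin> linked ?A}"
  have br: "(x, y) \<notin> linked ?A" using T \<epsilon> by (auto simp: tree_def bridges_def)
  have fin: "finite C" "finite T" "finite T'" using finite_N finite_F TF
    by (auto simp: C_def intro: finite_subset)
  have xC: "x \<in> C" and CN: "C \<subseteq> N" using br xyN by (auto simp: C_def)
  have "card {\<delta> \<in> T'. \<exists>u\<in>C \<inter> M. u \<in> \<delta>} \<le> card {\<delta> \<in> T'. \<delta> \<subseteq> C}"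
  proof (rule card_mono)
    show "{\<delta> \<in> T'. \<exists>u\<in>C \<inter> M. u \<in> \<delta>} \<subseteq> {\<delta> \<in> T'. \<delta> \<subseteq> C}"
    proof clarify
      fix \<delta> u w
      assume \<delta>: "\<delta> \<in> T'" "u \<in> C" "u \<in> M" "u \<in> \<delta>" and "w \<in> \<delta>"
      obtain w' where w': "\<delta> = {u, w'}" using \<delta> TF edge_at by blast
      have N: "w' \<in> N" using w' \<delta> TF edgeD by blast
      have hd: "(u, \<delta>) \<in> half_edges" "(w', \<delta>) \<in> half_edges"
        using \<delta> w' TF by (auto simp: half_edges_def)
      \<comment> \<open>An edge leaving \<open>C\<close> is not in \<open>T\<close>, since the only
        such edge of \<open>T\<close>, \<open>?\<epsilon>\<close>, is not in \<open>T'\<close>. So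
        \<open>T\<close> cuts it at \<open>u\<close> before meeting it at \<open>w'\<close>; as
        \<open>w'\<close> is visited within the interval and \<open>u\<close> outside it,
        \<open>u\<close> comes no later than time \<open>n\<close>, where the only possible
        disagreement is on \<open>?\<epsilon>\<close>.\<close>
      have "w' \<in> C"
      proof (rule ccontr)
        assume "w' \<notin> C"
        then have wy: "(w', y) \<in> linked ?A" using N by (simp add: C_def)
        have uy: "(u, y) \<notin> linked ?A" using \<delta> by (simp add: C_def)
        then have "(u, w') \<notin> linked ?A" using wy linked_trans[of u w' ?A y] by blast
        then have nT: "\<delta> \<notin> T" using w' \<delta> \<epsilon> linked_edge[of u w' ?A] by (metis DiffI singletonD)
        then have less: "visit T (u, \<delta>) < visit T (w', \<delta>)"
          using jT \<delta> TF w' unfolding jaeger_def by blast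
        have "n < visit T (w', \<delta>)" "visit T (w', \<delta>) \<le> visit T (y, ?\<epsilon>)"
          using interval[OF hd(2)] wy by auto
        then have "visit T (u, \<delta>) \<le> n" using less uy interval[OF hd(1)] by auto
        then have "\<delta> = ?\<epsilon>" using early(3)[OF hd(1)] nT \<delta> by simp
        then show False using \<delta> \<epsilon> by simp
      qed
      then show "w \<in> C" using \<open>w \<in> \<delta>\<close> w' \<delta> by auto
    qed
  qed (use fin in simp)
  also have "\<dots> < card C"
  proof (rule card_edges_within_less)
    show "bridges T'" "finite C" "x \<in> C" using T' fin xC by (auto simp: tree_def)
    show "(z, x) \<in> linked T'" if "z \<in> C" for z using that T' CN xyN by (auto simp: tree_def)
    show "\<exists>a b. \<delta> = {a, b}" if "\<delta> \<in> T'" for \<delta> using that TF bip by blast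
  qed
  also have "card C \<le> card {\<delta> \<in> ?A. \<delta> \<subseteq> C} + 1"
  proof (rule card_linked_class_le)
    have "linked (?A - {\<delta>}) \<subseteq> linked (T - {\<delta>})" for \<delta> by (intro linked_mono) auto
    then show "bridges ?A" using T unfolding tree_def bridges_def by blast
    show "finite ?A" "x \<in> C" using fin xC by auto
    show "(z, x) \<in> linked ?A" if "z \<in> C" for z
      using that T xyN linked_delete_split[of z x T y] by (auto simp: C_def tree_def)
    show "p \<in> C" if "z \<in> C" "{z, p} \<in> ?A" for z p
      using that TF edgeD[of z p] linked_trans[OF linked_edge[OF that(2)], of y] by (auto simp: C_def)
  qed
  \<comment> \<open>The extra 1 is \<open>?\<epsilon>\<close>, which leaves \<open>C\<close> but has
    its emerald end \<open>x\<close> in it; \<open>T'\<close> has no such edge.\<close>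
  also have "\<dots> = card (insert ?\<epsilon> {\<delta> \<in> ?A. \<delta> \<subseteq> C})" using fin by simp
  also have "\<dots> \<le> card {\<delta> \<in> T. \<exists>u\<in>C \<inter> M. u \<in> \<delta>}"
  proof (rule card_mono)
    have "\<exists>u\<in>C \<inter> M. u \<in> \<delta>" if "\<delta> \<in> T" "\<delta> \<subseteq> C" for \<delta> using that TF bip by blast
    then show "insert ?\<epsilon> {\<delta> \<in> ?A. \<delta> \<subseteq> C} \<subseteq> {\<delta> \<in> T. \<exists>u\<in>C \<inter> M. u \<in> \<delta>}" using xM xC \<epsilon> by auto
  qed (use fin in simp)
  also have "\<dots> = card {\<delta> \<in> T'. \<exists>u\<in>C \<inter> M. u \<in> \<delta>}"
    unfolding card_edges_by_degree[OF TF(1) CN] card_edges_by_degree[OF TF(2) CN]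
    using deg CN by (intro sum.cong) auto
  finally show False by simp
qed

text \<open>A step depends on the tree only through membership of the current edge. The decision at
  time \<open>n\<close> affects only later positions, so \<open>k = n\<close> is included.\<close>

lemma at_agree:
  assumes "\<And>k. k < n \<Longrightarrow> snd (at T k) \<in> T \<longleftrightarrow> snd (at T k) \<in> T'" "k \<le> n"
  shows "at T k = at T' k"
  using assms(2)
proof (induction k)
  case (Suc k)
  then show ?case using assms(1)[of k] by (cases "at T' k") (auto simp: at_Suc tour_step.simps)
qed simp

lemma jaeger_unique:
  assumes jT: "jaeger T" and jT': "jaeger T'"
    and deg: "\<And>u. u \<in> N \<inter> M \<Longrightarrow> node_degree T u = node_degree T' u"
  shows "T = T'"
proof (rule ccontr)
  assume "T \<noteq> T'"
  define n where "n = (LEAST n. \<not> (snd (at T n) \<in> T \<longleftrightarrow> snd (at T n) \<in> T'))"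
  have T: "tree T" and T': "tree T'" using jT jT' by (auto simp: jaeger_def)
  then obtain \<delta> where \<delta>: "\<delta> \<in> F" "\<not> (\<delta> \<in> T \<longleftrightarrow> \<delta> \<in> T')"
    using \<open>T \<noteq> T'\<close> unfolding tree_def by blast
  then obtain x where "(x, \<delta>) \<in> half_edges" using bip[of \<delta>] by (auto simp: half_edges_def)
  then have "\<exists>n. \<not> (snd (at T n) \<in> T \<longleftrightarrow> snd (at T n) \<in> T')"
    using visits_all[OF T] \<delta> by (metis snd_conv)
  from LeastI_ex[OF this] have n: "\<not> (snd (at T n) \<in> T \<longleftrightarrow> snd (at T n) \<in> T')"
    unfolding n_def .
  have before: "snd (at T k) \<in> T \<longleftrightarrow> snd (at T k) \<in> T'" if "k < n" for k
    using that not_less_Least unfolding n_def by blast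
  have same: "at T k = at T' k" if "k \<le> n" for k using at_agree[OF before that] .
  show False
  proof (cases "snd (at T n) \<in> T")
    case True
    then show ?thesis
      using first_difference_absurd[OF jT jT' deg same before] n by blast
  next
    case False
    \<comment> \<open>The two trees exchange roles, so the agreement has to be read off the tour of
      \<open>T'\<close>.\<close>
    have "snd (at T' k) \<in> T' \<longleftrightarrow> snd (at T' k) \<in> T" if "k < n" for k
      using before[OF that] same[of k] that by simp
    then show ?thesis
      using first_difference_absurd[OF jT' jT, of n] deg same n False by simp
  qed
qed

section \<open>Existence: weights of tours and the exchange that increases them\<close>

definition preferred :: "'n set set \<Rightarrow> 'n \<times> 'n set \<Rightarrow> bool" where
  "preferred T h \<longleftrightarrow> (fst h \<in> M \<longleftrightarrow> snd h \<notin> T)"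

text \<open>
  Reading the decisions along the tour as binary digits turns the lexicographic comparison into
  one of natural numbers.
\<close>

definition weight :: "'n set set \<Rightarrow> nat" where
  "weight T = (\<Sum>k<card half_edges. of_bool (preferred T (at T k)) * 2 ^ (card half_edges - k))"

text \<open>The tours coincide until \<open>T\<close> reaches \<open>h\<close>, so \<open>h\<close>
  has the same position in both; its digit is the first to differ, 0 for \<open>T\<close> and 1 for
  \<open>T'\<close>.\<close>

lemma weight_less:
  assumes T: "tree T" and h: "h \<in> half_edges"
    and diff: "\<not> preferred T h" "preferred T' h"
    and before: "\<And>h'. h' \<in> half_edges \<Longrightarrow> visit T h' < visit T h \<Longrightarrow> snd h' \<in> T \<longleftrightarrow> snd h' \<in> T'"
  shows "weight T < weight T'"
proof -
  let ?n = "visit T h"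
  have before': "snd (at T k) \<in> T \<longleftrightarrow> snd (at T k) \<in> T'" if "k < ?n" for k
    using before[OF at_half_edge, of T k] visit_le[of T k "at T k"] that by simp
  have same: "at T k = at T' k" if "k \<le> ?n" for k using at_agree[OF before' that] .
  show ?thesis unfolding weight_def
  proof (rule binary_weight_less[of ?n])
    show "?n < card half_edges" using visit_less_length[OF T h] tour_length_le by (rule less_le_trans)
    show "preferred T (at T k) = preferred T' (at T' k)" if "k < ?n" for k
      using before'[OF that] same[of k] that by (simp add: preferred_def)
    show "\<not> preferred T (at T ?n)" "preferred T' (at T' ?n)"
      using diff same[of ?n] at_visit[OF T h] by simp_all
  qed
qed

text \<open>At \<open>e\<close> one edge is lost and one gained. The excluded nodes \<open>v\<close>
  and \<open>p\<close> are violet in the application.\<close>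

lemma node_degree_exchange:
  assumes "finite T" "{e, p} \<in> T" "{v, e} \<notin> T" "u \<noteq> v" "u \<noteq> p"
  shows "node_degree (insert {v, e} (T - {{e, p}})) u = node_degree T u"
proof (cases "u = e")
  case True
  have "incident (insert {v, e} (T - {{e, p}})) e = insert {v, e} (incident T e - {{e, p}})"
    by (auto simp: incident_def)
  moreover have "finite (incident T e)" "{e, p} \<in> incident T e" "{v, e} \<notin> incident T e"
    using assms by (auto simp: incident_def)
  ultimately show ?thesis 
    using True card_gt_0_iff[of "incident T e"] by (auto simp: node_degree_def)
next
  case False
  then have "incident (insert {v, e} (T - {{e, p}})) u = incident T u"
    using assms by (auto simp: incident_def)
  then show ?thesis by (simp add: node_degree_def)
qed

text \<open>For connectedness, the deleted edge is replaced by the route from \<open>p\<close> to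
  \<open>v\<close> and on to \<open>e\<close>.\<close>

lemma tree_exchange:
  assumes T: "tree T" and ep: "{e, p} \<in> T" and ve: "{v, e} \<in> F"
    and pv: "(p, v) \<in> linked (T - {{e, p}})"
  shows "tree (insert {v, e} (T - {{e, p}}))"
proof -
  let ?T = "insert {v, e} (T - {{e, p}})"
  have TF: "T \<subseteq> F" using T by (simp add: tree_def)
  have "{x} \<notin> T" for x using TF bip by (fastforce simp: doubleton_eq_iff)
  then have "bridges ?T" using bridges_exchange[OF _ ep pv] T by (auto simp: tree_def)
  moreover have "(a, b) \<in> linked ?T" if "(a, b) \<in> linked T" for a b
    using that
  proof (induction rule: linked_induct)
    case (step u w)
    have "linked (T - {{e, p}}) \<subseteq> linked ?T" by (intro linked_mono) auto
    then have "(p, v) \<in> linked ?T" using pv by blast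
    moreover have "(v, e) \<in> linked ?T" by (intro linked_edge) simp
    ultimately have pe: "(p, e) \<in> linked ?T" by (rule linked_trans)
    have "(u, w) \<in> linked ?T"
    proof (cases "{u, w} = {e, p}")
      case True
      then show ?thesis using pe linked_sym by (auto simp: doubleton_eq_iff)
    next
      case False
      then show ?thesis using step.hyps by (intro linked_edge) auto
    qed
    then show ?case using step.IH by (rule linked_trans)
  qed simp
  ultimately show ?thesis using T ve TF unfolding tree_def by blast
qed

text \<open>
  If \<open>{v, e}\<close> is cut at its violet end \<open>v\<close>, exchange it with the first edge of the tree path from \<open>e\<close>
  to \<open>v\<close>. Depending on whether \<open>e\<close> is an ancestor of \<open>v\<close> with respect to the base node, the first
  affected decision is either at \<open>e\<close>, where an edge is now cut, or at \<open>v\<close>, where one is now kept.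
\<close>

lemma violet_cut_improve:
  assumes T: "tree T" and ve: "{v, e} \<in> F" "{v, e} \<notin> T" and e: "e \<in> M"
    and first: "visit T (v, {v, e}) < visit T (e, {v, e})"
  obtains T' where "tree T'" "\<And>u. u \<in> N \<inter> M \<Longrightarrow> node_degree T' u = node_degree T u"
    "weight T < weight T'"
proof -
  have TF: "T \<subseteq> F" using T by (simp add: tree_def)
  have vN: "v \<in> N" "e \<in> N" "v \<noteq> e" "v \<notin> M" using edgeD[OF ve(1)] e by auto
  then have "(e, v) \<in> linked T" using T by (simp add: tree_def)
  then obtain p where p: "{e, p} \<in> T" "(p, v) \<in> linked {\<delta> \<in> T. e \<notin> \<delta>}"
    using linked_first_edge[of e v T] vN(3) by blast
  let ?A = "T - {{e, p}}" and ?\<epsilon> = "{v, e}" and ?\<epsilon>' = "{e, p}"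
  let ?T = "insert ?\<epsilon> ?A"
  have pN: "p \<in> N" "p \<notin> M" "p \<noteq> e" using edgeD[of e p] p TF e by auto
  have "linked {\<delta> \<in> T. e \<notin> \<delta>} \<subseteq> linked ?A" by (intro linked_mono) auto
  then have pv: "(p, v) \<in> linked ?A" using p by blast
  have br: "(e, p) \<notin> linked ?A" using T p by (auto simp: tree_def bridges_def)
  then have ev: "(e, v) \<notin> linked ?A" using linked_trans[of e v ?A p] linked_sym[OF pv] by blast
  have ne: "?\<epsilon> \<noteq> ?\<epsilon>'" using p ve by auto
  have h: "(v, ?\<epsilon>) \<in> half_edges" "(e, ?\<epsilon>) \<in> half_edges" "(e, ?\<epsilon>') \<in> half_edges" "(p, ?\<epsilon>') \<in> half_edges"
    using ve p TF by (auto simp: half_edges_def)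
  have inj: "g = g'" if "visit T g = visit T g'" "g \<in> half_edges" "g' \<in> half_edges" for g g'
    using at_visit[OF T] that by metis
  \<comment> \<open>Only the four half-edges of the exchanged edges change their decision, so the
    first of them in the tour of \<open>T\<close> settles the comparison.\<close>
  have keep: "snd h' \<in> T \<longleftrightarrow> snd h' \<in> ?T"
    if "h' \<in> half_edges" "h' \<notin> {(v, ?\<epsilon>), (e, ?\<epsilon>), (e, ?\<epsilon>'), (p, ?\<epsilon>')}" for h'
  proof -
    have "snd h' \<noteq> {a, b}" if "h' \<noteq> (a, {a, b})" "h' \<noteq> (b, {a, b})" for a b
      using that \<open>h' \<in> half_edges\<close> by (cases h') (auto simp: half_edges_def)
    then have "snd h' \<noteq> ?\<epsilon>" "snd h' \<noteq> ?\<epsilon>'" using that(2) by simp_all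
    then show ?thesis by simp
  qed
  have "visit T (e, ?\<epsilon>') \<noteq> visit T (p, ?\<epsilon>')" using inj h pN by blast
  then consider "visit T (e, ?\<epsilon>') < visit T (p, ?\<epsilon>')" | "visit T (p, ?\<epsilon>') < visit T (e, ?\<epsilon>')"
    by linarith
  then have "weight T < weight ?T"
  proof cases
    \<comment> \<open>Here \<open>v\<close> lies beyond \<open>?\<epsilon>'\<close>, so
      \<open>(e, ?\<epsilon>')\<close> precedes the other three; there the emerald node
      \<open>e\<close> now cuts.\<close>
    case 1
    then have "visit T (e, ?\<epsilon>') < visit T (v, ?\<epsilon>)"
      using visit_interval[OF T p(1) 1 h(1)] linked_sym[OF pv] by simp
    show ?thesis
    proof (rule weight_less[OF T h(3)])
      show "\<not> preferred T (e, ?\<epsilon>')" "preferred ?T (e, ?\<epsilon>')"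
        using e p ne by (auto simp: preferred_def)
      fix h' assume h': "h' \<in> half_edges" "visit T h' < visit T (e, ?\<epsilon>')"
      then have "h' \<notin> {(v, ?\<epsilon>), (e, ?\<epsilon>), (e, ?\<epsilon>'), (p, ?\<epsilon>')}"
        using 1 first \<open>visit T (e, ?\<epsilon>') < visit T (v, ?\<epsilon>)\<close> by auto
      then show "snd h' \<in> T \<longleftrightarrow> snd h' \<in> ?T" using keep h'(1) by blast
    qed
  next
    \<comment> \<open>Here the side of \<open>e\<close> is the interval; it contains
      \<open>(e, ?\<epsilon>)\<close> but not \<open>(v, ?\<epsilon>)\<close>. As
      \<open>?\<epsilon>\<close> is met first at \<open>v\<close>, \<open>(v, ?\<epsilon>)\<close>
      precedes the whole interval; there the violet node \<open>v\<close> now keeps.\<close>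
    case 2
    have pe: "{p, e} \<in> T" "{p, e} = {e, p}" using p by (simp_all add: insert_commute)
    have int: "(z, e) \<in> linked ?A \<longleftrightarrow>
        visit T (p, ?\<epsilon>') < visit T (z, \<delta>) \<and> visit T (z, \<delta>) \<le> visit T (e, ?\<epsilon>')"
      if "(z, \<delta>) \<in> half_edges" for z \<delta>
      using visit_interval[OF T pe(1) _ that] 2 pe(2) by simp
    have "visit T (e, ?\<epsilon>) \<le> visit T (e, ?\<epsilon>')" using int[OF h(2)] by simp
    moreover have "\<not> (visit T (p, ?\<epsilon>') < visit T (v, ?\<epsilon>) \<and> visit T (v, ?\<epsilon>) \<le> visit T (e, ?\<epsilon>'))"
      using int[OF h(1)] ev linked_sym[of v e ?A] by blast
    moreover have "visit T (v, ?\<epsilon>) \<noteq> visit T (p, ?\<epsilon>')" using inj h ne by blast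
    ultimately have less: "visit T (v, ?\<epsilon>) < visit T (p, ?\<epsilon>')" using first by linarith
    show ?thesis
    proof (rule weight_less[OF T h(1)])
      show "\<not> preferred T (v, ?\<epsilon>)" "preferred ?T (v, ?\<epsilon>)"
        using vN ve by (auto simp: preferred_def)
      fix h' assume h': "h' \<in> half_edges" "visit T h' < visit T (v, ?\<epsilon>)"
      then have "h' \<notin> {(v, ?\<epsilon>), (e, ?\<epsilon>), (e, ?\<epsilon>'), (p, ?\<epsilon>')}"
        using 2 first less by auto
      then show "snd h' \<in> T \<longleftrightarrow> snd h' \<in> ?T" using keep h'(1) by blast
    qed
  qed
  moreover have "tree ?T" using tree_exchange[OF T p(1) ve(1) pv] .
  moreover have "node_degree ?T u = node_degree T u" if "u \<in> N \<inter> M" for u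
    using that vN pN p ve TF finite_F by (intro node_degree_exchange) (auto intro: finite_subset)
  ultimately show ?thesis using that by blast
qed

lemma jaeger_exists:
  assumes "tree S"
  shows "\<exists>T. jaeger T \<and> (\<forall>u\<in>N \<inter> M. node_degree T u = node_degree S u)"
proof -
  let ?\<T> = "{T. tree T \<and> (\<forall>u\<in>N \<inter> M. node_degree T u = node_degree S u)}"
  have "finite ?\<T>"
    by (rule finite_subset[of _ "Pow F"]) (use finite_F in \<open>auto simp: tree_def\<close>)
  then have fin: "finite (weight ` ?\<T>)" by (rule finite_imageI)
  moreover have "weight ` ?\<T> \<noteq> {}" using assms by blast
  ultimately have "Max (weight ` ?\<T>) \<in> weight ` ?\<T>" by (rule Max_in)
  then obtain T where T: "T \<in> ?\<T>" and "weight T = Max (weight ` ?\<T>)" by (metis (no_types, lifting) imageE)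
  then have max: "weight T' \<le> weight T" if "T' \<in> ?\<T>" for T'
    using Max_ge[OF fin imageI[OF that]] by simp
  have "visit T (x, {x, y}) < visit T (y, {x, y})" if xy: "{x, y} \<in> F - T" "x \<in> M" for x y
  proof (rule ccontr)
    assume n: "\<not> visit T (x, {x, y}) < visit T (y, {x, y})"
    have "(x, {x, y}) \<in> half_edges" "(y, {x, y}) \<in> half_edges" "x \<noteq> y"
      using that edgeD by (auto simp: half_edges_def)
    then have "visit T (x, {x, y}) \<noteq> visit T (y, {x, y})"
      using at_visit[of T] T by (metis (no_types, lifting) mem_Collect_eq prod.inject)
    then have less: "visit T (y, {y, x}) < visit T (x, {y, x})" using n by (simp add: insert_commute)
    have "{y, x} \<in> F" "{y, x} \<notin> T" using that by (simp_all add: insert_commute)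
    then obtain T' where "tree T'" "\<And>u. u \<in> N \<inter> M \<Longrightarrow> node_degree T' u = node_degree T u"
      "weight T < weight T'"
      using violet_cut_improve[of T y x] T less xy(2) by blast
    then show False using max[of T'] T by auto
  qed
  then show ?thesis using T by (auto simp: jaeger_def)
qed

end

theorem theorem6p15:
  fixes V :: "'v set" and E :: "'e set" and mem :: "'e \<Rightarrow> 'v set"
    and rot :: "'v + 'e \<Rightarrow> ('v + 'e) set \<Rightarrow> ('v + 'e) set"
    and b0 b1 :: "'v + 'e" and f :: "'e \<Rightarrow> nat"
  assumes "connected_hypergraph V E mem"
    and "ribbon_structure (bip_nodes V E) (bip_edges V E mem) rot"
    and "b0 \<in> bip_nodes V E" and "{b0, b1} \<in> bip_edges V E mem"
    and "hypertree V E mem f"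
  shows "\<exists>!T. E_cut_Jaeger_tree V E mem rot (b0, {b0, b1}) T \<and> (\<forall>e\<in>E. f_E T e = f e)"
proof -
  let ?N = "bip_nodes V E" and ?F = "bip_edges V E mem"
  \<comment> \<open>The whole range matches the quantifier over all \<open>e\<close> in
    \<open>E_cut_Jaeger_tree_def\<close>.\<close>
  let ?M = "range Inr :: ('v + 'e) set"
  have hyp: "hypergraph V E mem" using assms(1) by (simp add: connected_hypergraph_def)
  interpret ribbon_bigraph ?N ?M ?F rot "(b0, {b0, b1})"
  proof
    show "finite ?N" using hyp by (simp add: hypergraph_def bip_nodes_def)
    show "\<exists>x\<in>?N \<inter> ?M. \<exists>y\<in>?N - ?M. \<delta> = {x, y}" if \<delta>: "\<delta> \<in> ?F" for \<delta>
    proof -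
      obtain v e where "\<delta> = {Inl v, Inr e}" "v \<in> V" "e \<in> E"
        using \<delta> by (auto simp: bip_edges_def)
      then show ?thesis
        by (intro bexI[of _ "Inr e"] bexI[of _ "Inl v"]) (auto simp: bip_nodes_def)
    qed
  qed (use assms in auto)
  have NM: "?N \<inter> ?M = Inr ` E" by (auto simp: bip_nodes_def)
  have J: "E_cut_Jaeger_tree V E mem rot (b0, {b0, b1}) T \<longleftrightarrow> jaeger T" for T
    unfolding E_cut_Jaeger_tree_def jaeger_iff by blast
  \<comment> \<open>The truncated subtraction is harmless: a nonempty hyperedge provides a second
    node, so connectedness gives \<open>Inr e\<close> positive degree.\<close>
  have deg: "f_E T e = f e \<longleftrightarrow> node_degree T (Inr e) = f e + 1" if T: "tree T" and e: "e \<in> E" for T e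
  proof -
    obtain v where v: "v \<in> V" using hyp e unfolding hypergraph_def by blast
    have "Inr e \<in> ?N" "Inl v \<in> ?N" using e v by (auto simp: bip_nodes_def)
    then have "(Inr e, Inl v) \<in> linked T" using T by (simp add: tree_def)
    then obtain p where "{Inr e, p} \<in> T" using linked_first_edge[of "Inr e" "Inl v" T] by auto
    moreover have "finite T" using T finite_F by (auto simp: tree_def intro: finite_subset)
    ultimately have "node_degree T (Inr e) > 0"
      by (auto simp: node_degree_def incident_def card_gt_0_iff)
    then show ?thesis by (auto simp: f_E_def)
  qed
  obtain S where S: "tree S" "\<forall>e\<in>E. node_degree S (Inr e) = f e + 1"
    using assms(5) unfolding hypertree_def tree_iff by blast
  obtain T where T: "jaeger T" "\<forall>u\<in>?N \<inter> ?M. node_degree T u = node_degree S u"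
    using jaeger_exists[OF S(1)] by blast
  show ?thesis
  proof (rule ex1I[of _ T])
    show "E_cut_Jaeger_tree V E mem rot (b0, {b0, b1}) T \<and> (\<forall>e\<in>E. f_E T e = f e)"
      using T S deg[of T] by (auto simp: J NM jaeger_def)
    fix T' assume "E_cut_Jaeger_tree V E mem rot (b0, {b0, b1}) T' \<and> (\<forall>e\<in>E. f_E T' e = f e)"
    then have T': "jaeger T'" "\<forall>e\<in>E. f_E T' e = f e" by (auto simp: J)
    then have "node_degree T' u = node_degree T u" if "u \<in> ?N \<inter> ?M" for u
      using that T S T'(2) deg[of T'] by (auto simp: NM jaeger_def)
    then show "T' = T" using jaeger_unique[OF T'(1) T(1)] by blast
  qed
qed

end
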